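(* The space of Shannon-equivalent channels $\mathrm{DMC}_{\ast,\ast}^{(s)}$ endowed with the strong topology $\mathcal{T}_{s,\ast,\ast}^{(s)}$ is a compactly generated, sequential and $T_4$ space.
   Context: For $n,m\ge1$ and $[n]=\{1,\dots,n\}$, $\mathrm{DMC}_{[n],[m]}$ is the set of channels from $[n]$ to $[m]$, i.e. families $W=(W(y|x))_{x\in[n],y\in[m]}$ of non-negative reals with $\sum_{y}W(y|x)=1$ for every $x$, with the topology $\mathcal{T}_{[n],[m]}$ inherited from $\mathbb{R}^{[n]\times[m]}$. Composition: $(V\circ W)(z|x)=\sum_yV(z|y)W(y|x)$. A channel $W'$ from $\mathcal{X}'$ to $\mathcal{Y}'$ contains a channel $W$ from $\mathcal{X}$ to $\mathcal{Y}$ if there exist $k\geq 1$, a probability distribution $\alpha$ on $[k]$, channels $R_i$ from $\mathcal{X}$ to $\mathcal{X}'$ and $T_i$ from $\mathcal{Y}'$ to $\mathcal{Y}$ ($1\le i\le k$) such that $W=\sum_{i=1}^k\alpha(i)\,T_i\circ W'\circ R_i$. Two channels are Shannon-equivalent if each contains the other. Let $\mathrm{DMC}_{\ast,\ast}=\coprod_{n,m\ge1}\mathrm{DMC}_{[n],[m]}$ with the disjoint union topology $\mathcal{T}_{s,\ast,\ast}=\bigoplus_{n,m\ge1}\mathcal{T}_{[n],[m]}$, and let $\mathrm{DMC}_{\ast,\ast}^{(s)}$ be the quotient of $\mathrm{DMC}_{\ast,\ast}$ by the Shannon-equivalence relation. The strong topology $\mathcal{T}_{s,\ast,\ast}^{(s)}$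 is the quotient topology of $\mathcal{T}_{s,\ast,\ast}$. Compactly generated means: Hausdorff, and a subset is closed whenever its intersection with every compact subset is closed. Sequential means every sequentially closed subset is closed. $T_4$ means $T_1$ and normal (disjoint closed sets have disjoint open neighbourhoods). *)

theory Defs
  imports "HOL-Analysis.Analysis"
begin

definition sequentially_closed_in :: "'a topology \<Rightarrow> 'a set \<Rightarrow> bool" where
  "sequentially_closed_in X S \<longleftrightarrow>
     S \<subseteq> topspace X \<and>
     (\<forall>\<sigma> l. (\<forall>k::nat. \<sigma> k \<in> S) \<and> limitin X \<sigma> l sequentially \<longrightarrow> l \<in> S)"

definition sequential_space :: "'a topology \<Rightarrow> bool" where
  "sequential_space X \<longleftrightarrow> (\<forall>S. sequentially_closed_in X S \<longrightarrow> closedin X S)"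

definition compactly_generated_space :: "'a topology \<Rightarrow> bool" where
  "compactly_generated_space X \<longleftrightarrow>
     Hausdorff_space X \<and>
     (\<forall>S. S \<subseteq> topspace X \<and> (\<forall>K. compactin X K \<longrightarrow> closedin X (S \<inter> K)) \<longrightarrow> closedin X S)"

lemma compactly_generated_space_iff_k_space:
  "compactly_generated_space X \<longleftrightarrow> Hausdorff_space X \<and> k_space X"
proof (cases "Hausdorff_space X")
  case True
  then have "closedin X (S \<inter> K) \<longleftrightarrow> closedin (subtopology X K) (K \<inter> S)"
    if "compactin X K" for S K
    using that
    by (simp add: closedin_closed_subtopology compactin_imp_closedin Int_commute)
  with True show ?thesis
    unfolding compactly_generated_space_def k_space by meson
next
  case False
  then show ?thesis
    by (simp add: compactly_generated_space_def)
qed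

definition T4_space :: "'a topology \<Rightarrow> bool" where
  "T4_space X \<longleftrightarrow> t1_space X \<and> normal_space X"

definition quotient_topology :: "'a topology \<Rightarrow> ('a \<times> 'a) set \<Rightarrow> 'a set topology" where
  "quotient_topology X R =
     topology (\<lambda>U. U \<subseteq> topspace X // R \<and> openin X {x \<in> topspace X. R `` {x} \<in> U})"

lemma istopology_quotient:
  "istopology (\<lambda>U. U \<subseteq> topspace X // R \<and> openin X {x \<in> topspace X. R `` {x} \<in> U})"
proof -
  have Int: "{x \<in> topspace X. R `` {x} \<in> S \<inter> T} =
      {x \<in> topspace X. R `` {x} \<in> S} \<inter> {x \<in> topspace X. R `` {x} \<in> T}" for S T
    by (simp add: set_eq_iff conj_ac)
  have Union: "{x \<in> topspace X. R `` {x} \<in> \<Union>\<K>} =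
      (\<Union>K\<in>\<K>. {x \<in> topspace X. R `` {x} \<in> K})" for \<K>
    by (simp add: set_eq_iff)
  show ?thesis
    unfolding istopology_def Int Union
    by (simp add: openin_Int Union_least le_infI1) (intro allI impI openin_Union; auto)
qed

lemma openin_quotient_topology:
  "openin (quotient_topology X R) U \<longleftrightarrow>
     U \<subseteq> topspace X // R \<and> openin X {x \<in> topspace X. R `` {x} \<in> U}"
  unfolding quotient_topology_def by (subst topology_inverse'[OF istopology_quotient], rule refl)

lemma topspace_quotient_topology: "topspace (quotient_topology X R) = topspace X // R"
proof (rule subset_antisym)
  show "topspace (quotient_topology X R) \<subseteq> topspace X // R"
    using openin_quotient_topology[of X R] openin_topspace by blast
next
  have "{x \<in> topspace X. R `` {x} \<in> topspace X // R} = topspace X"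
    by (auto intro: quotientI)
  then have "openin (quotient_topology X R) (topspace X // R)"
    by (simp add: openin_quotient_topology)
  then show "topspace X // R \<subseteq> topspace (quotient_topology X R)"
    by (rule openin_subset)
qed

lemma quotient_map_quotient_topology:
  "quotient_map X (quotient_topology X R) (\<lambda>x. R `` {x})"
  unfolding quotient_map_def topspace_quotient_topology openin_quotient_topology
proof (intro conjI allI impI)
  show "(\<lambda>x. R `` {x}) ` topspace X = topspace X // R"
    by (simp add: quotient_def UNION_singleton_eq_range)
qed simp

text \<open>
  The transition probability \<open>W(y|x)\<close> of a channel from \<open>{1..n}\<close> to \<open>{1..m}\<close> is written
  \<open>W (x, y)\<close>: the input letter comes first. Channels are extensional functions, i.e.
  \<open>undefined\<close> outside \<open>{1..n} \<times> {1..m}\<close>, in accordance with \<^const>\<open>product_topology\<close>.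
\<close>

type_synonym channel = "nat \<times> nat \<Rightarrow> real"

definition DMC :: "nat \<Rightarrow> nat \<Rightarrow> channel set" where
  "DMC n m = {W \<in> {1..n} \<times> {1..m} \<rightarrow>\<^sub>E UNIV.
     (\<forall>x\<in>{1..n}. \<forall>y\<in>{1..m}. 0 \<le> W (x, y)) \<and>
     (\<forall>x\<in>{1..n}. (\<Sum>y\<in>{1..m}. W (x, y)) = 1)}"

definition DMC_topology :: "nat \<Rightarrow> nat \<Rightarrow> channel topology" where
  "DMC_topology n m =
     subtopology (product_topology (\<lambda>_. euclideanreal) ({1..n} \<times> {1..m})) (DMC n m)"

text \<open>
  \<open>channel_comp n m l V W\<close> is the composition \<open>V \<circ> W\<close> of \<open>W\<close> from \<open>{1..n}\<close> to \<open>{1..m}\<close>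
  with \<open>V\<close> from \<open>{1..m}\<close> to \<open>{1..l}\<close>.
\<close>

definition channel_comp ::
    "nat \<Rightarrow> nat \<Rightarrow> nat \<Rightarrow> channel \<Rightarrow> channel \<Rightarrow> channel" where
  "channel_comp n m l V W =
     (\<lambda>(x, z)\<in>{1..n} \<times> {1..l}. \<Sum>y\<in>{1..m}. V (y, z) * W (x, y))"

definition channel_contains ::
    "nat \<Rightarrow> nat \<Rightarrow> channel \<Rightarrow> nat \<Rightarrow> nat \<Rightarrow> channel \<Rightarrow> bool" where
  "channel_contains n' m' W' n m W \<longleftrightarrow>
     (\<exists>(k::nat) (\<alpha>::nat \<Rightarrow> real) (R::nat \<Rightarrow> channel) (T::nat \<Rightarrow> channel).
        k \<ge> 1 \<and>
        (\<forall>i\<in>{1..k}. 0 \<le> \<alpha> i) \<and> (\<Sum>i\<in>{1..k}. \<alpha> i) = 1 \<and>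
        (\<forall>i\<in>{1..k}. R i \<in> DMC n n' \<and> T i \<in> DMC m' m) \<and>
        (\<forall>x\<in>{1..n}. \<forall>y\<in>{1..m}.
           W (x, y) =
           (\<Sum>i\<in>{1..k}. \<alpha> i *
              channel_comp n m' m (T i) (channel_comp n n' m' W' (R i)) (x, y))))"

text \<open>The disjoint union carries its index: its elements are \<open>((n, m), W)\<close> with \<open>W \<in> DMC n m\<close>.\<close>

definition DMC_all :: "((nat \<times> nat) \<times> channel) set" where
  "DMC_all = (SIGMA (n, m) : {1..} \<times> {1..}. DMC n m)"

definition DMC_all_topology :: "((nat \<times> nat) \<times> channel) topology" where
  "DMC_all_topology = sum_topology (\<lambda>(n, m). DMC_topology n m) ({1..} \<times> {1..})"

lemma topspace_DMC_all_topology: "topspace DMC_all_topology = DMC_all"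
proof -
  have "topspace (DMC_topology n m) = DMC n m" for n m
    unfolding DMC_topology_def by (auto simp: DMC_def)
  then show ?thesis
    unfolding DMC_all_topology_def DMC_all_def by (simp add: case_prod_unfold comp_def)
qed

definition Shannon_equivalence ::
    "(((nat \<times> nat) \<times> channel) \<times> ((nat \<times> nat) \<times> channel)) set" where
  "Shannon_equivalence =
     {(((n, m), W), ((n', m'), W')).
        ((n, m), W) \<in> DMC_all \<and> ((n', m'), W') \<in> DMC_all \<and>
        channel_contains n m W n' m' W' \<and> channel_contains n' m' W' n m W}"

definition Shannon_channel_space :: "((nat \<times> nat) \<times> channel) set set" where
  "Shannon_channel_space = DMC_all // Shannon_equivalence"

definition strong_topology :: "((nat \<times> nat) \<times> channel) set topology" where
  "strong_topology = quotient_topology DMC_all_topology Shannon_equivalence"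

lemma topspace_strong_topology: "topspace strong_topology = Shannon_channel_space"
  by (simp add: strong_topology_def Shannon_channel_space_def topspace_quotient_topology
      topspace_DMC_all_topology)

end

theory Submission
  imports Defs
begin

text \<open>
  Every channel is a convex combination of deterministic ones, so \<open>W'\<close> contains \<open>W\<close> iff \<open>W\<close> is a
  mixture of the finitely many channels obtained from \<open>W'\<close> by relabelling inputs and outputs along
  maps of letters. The mixing weights range over a compact simplex, hence containment is a closed
  relation. As each \<open>DMC n m\<close> is compact, its canonical map to the quotient is therefore closed.
  Thus the quotient is covered by countably many compact, closed, normal pieces whose topology it
  is coherent with. Normality follows by extending a Urysohn function piece by piece with Tietze's
  theorem; the other properties are inherited from the compact metrizable spaces \<open>DMC n m\<close>.
\<close>

subsection \<open>Spaces coherent with countably many closed images\<close>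

text \<open>Tietze on the normal piece \<open>J\<close> extends the restriction of \<open>f\<close>
  to \<open>J \<inter> K\<close>; the two functions agree on the overlap of two closed sets and so
  paste continuously. This is the inductive step of the Urysohn construction.\<close>

lemma closed_function_extension:
  fixes f :: "'a \<Rightarrow> real"
  assumes K: "closedin Y K" and J: "closedin Y J" and norm: "normal_space (subtopology Y J)"
    and f: "continuous_map (subtopology Y K) euclideanreal f"
  obtains g where "continuous_map (subtopology Y (K \<union> J)) euclideanreal g"
    and "\<And>x. x \<in> K \<Longrightarrow> g x = f x"
proof -
  have "continuous_map (subtopology (subtopology Y J) (J \<inter> K)) euclideanreal f"
    using continuous_map_from_subtopology_mono[OF f]
    by (metis Int_lower2 inf.left_idem subtopology_subtopology)
  moreover have "closedin (subtopology Y J) (J \<inter> K)"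
    by (simp add: J K closedin_Int closedin_subset_topspace)
  ultimately obtain h where h: "continuous_map (subtopology Y J) euclideanreal h"
      and hf: "\<And>x. x \<in> J \<inter> K \<Longrightarrow> h x = f x"
    using Tietze_extension_realinterval[OF norm, of "J \<inter> K" UNIV f]
    by (metis UNIV_not_empty is_interval_univ top_greatest)
  have KY: "K \<subseteq> topspace Y" "J \<subseteq> topspace Y"
    using K J closedin_subset by auto
  define g where "g x = (if x \<in> K then f x else h x)" for x
  have preimage: "closedin Y {x \<in> K \<union> J. g x \<in> C}" if "closed C" for C
  proof -
    have "closedin (subtopology Y K) {x \<in> K. f x \<in> C}" "closedin (subtopology Y J) {x \<in> J. h x \<in> C}"
      using f h that KY by (simp_all add: continuous_map_closedin Int_absorb1)
    then have "closedin Y {x \<in> K. f x \<in> C}" "closedin Y {x \<in> J. h x \<in> C}"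
      using closedin_trans_full K J by blast+
    moreover have "{x \<in> K \<union> J. g x \<in> C} = {x \<in> K. f x \<in> C} \<union> {x \<in> J. h x \<in> C}"
      using hf by (auto simp: g_def)
    ultimately show ?thesis
      by (simp add: closedin_Un)
  qed
  have "continuous_map (subtopology Y (K \<union> J)) euclideanreal g"
  proof -
    have "topspace (subtopology Y (K \<union> J)) = K \<union> J"
      using KY by auto
    then show ?thesis
      using preimage
      unfolding continuous_map_closedin
      by (auto intro!: closedin_subset_topspace)
  qed
  then show thesis
    using that by (simp add: g_def)
qed

text \<open>
  A Urysohn function for \<open>A\<close> and \<open>B\<close> is first defined on \<open>A \<union> B\<close> and then extended over
  one member of the cover at a time.
\<close>

lemma normal_space_coherent_countable_closed_cover:
  fixes J :: "nat \<Rightarrow> 'a set"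
  assumes J: "\<And>n. closedin Y (J n)" and norm: "\<And>n. normal_space (subtopology Y (J n))"
    and cover: "topspace Y \<subseteq> (\<Union>n. J n)"
    and coherent: "\<And>S. S \<subseteq> topspace Y \<Longrightarrow> (\<And>n. closedin Y (S \<inter> J n)) \<Longrightarrow> closedin Y S"
  shows "normal_space Y"
  unfolding normal_space_iff_Urysohn_alt
proof (intro allI impI, elim conjE)
  fix A B
  assume A: "closedin Y A" and B: "closedin Y B" and AB: "disjnt A B"
  \<comment> \<open>\<open>K 0\<close> is just \<open>A \<union> B\<close>, where the construction
    starts. \<open>K n\<close> adds only the pieces of index below \<open>n\<close>, so
    \<open>J n\<close> is first guaranteed to lie in \<open>K (Suc n)\<close>.\<close>
  define K where "K n = A \<union> B \<union> (\<Union>i<n. J i)" for n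
  have K: "closedin Y (K n)" for n
    unfolding K_def using A B J by (intro closedin_Un closedin_Union) auto
  define P where "P n f \<longleftrightarrow> continuous_map (subtopology Y (K n)) euclideanreal f
      \<and> (\<forall>x\<in>A. f x = 0) \<and> (\<forall>x\<in>B. f x = 1)" for n and f :: "'a \<Rightarrow> real"
  define Q where "Q n f g \<longleftrightarrow> (\<forall>x\<in>K n. g x = f x)" for n and f g :: "'a \<Rightarrow> real"
  have "\<exists>f. P 0 f"
  proof
    \<comment> \<open>Under the indicator of \<open>B\<close>, the preimage of any set is empty,
      \<open>A\<close>, \<open>B\<close> or \<open>A \<union> B\<close>, and all of these are
      closed.\<close>
    have "{x \<in> A \<union> B. indicator B x \<in> C} = (if 0 \<in> C then A else {}) \<union> (if 1 \<in> C then B else {})"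
      for C :: "real set"
      using AB by (auto simp: indicator_def disjnt_iff)
    moreover have "A \<union> B \<subseteq> topspace Y"
      using A B closedin_subset by blast
    ultimately show "P 0 (indicator B)"
      using A B AB
      by (auto simp: P_def K_def continuous_map_closedin Int_absorb1 closedin_closed_subtopology
          closedin_Un disjnt_iff)
  qed
  moreover have "\<exists>g. P (Suc n) g \<and> Q n f g" if f: "P n f" for n f
  proof -
    have "K (Suc n) = K n \<union> J n"
      by (auto simp: K_def lessThan_Suc)
    moreover have "A \<union> B \<subseteq> K n"
      by (auto simp: K_def)
    moreover obtain g where "continuous_map (subtopology Y (K n \<union> J n)) euclideanreal g"
        "\<And>x. x \<in> K n \<Longrightarrow> g x = f x"
      using closed_function_extension[OF K J norm] f P_def by blast
    ultimately have "P (Suc n) g \<and> Q n f g"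
      using f by (auto simp: P_def Q_def subset_eq)
    then show ?thesis by blast
  qed
  ultimately obtain F where F: "\<And>n. P n (F n)" "\<And>n. Q n (F n) (F (Suc n))"
    using dependent_nat_choice[of P Q] by blast
  have mono: "K n \<subseteq> K m" if "n \<le> m" for n m
    using that by (fastforce simp: K_def)
  have F_eq: "F m x = F n x" if "n \<le> m" "x \<in> K n" for n m x
    using that(1)
  proof (induction m rule: dec_induct)
    case (step m)
    then show ?case
      using F(2)[of m] mono[of n m] that(2) by (auto simp: Q_def)
  qed simp
  \<comment> \<open>All stages defined at \<open>x\<close> give the same value there, so taking the
    least one is merely a canonical choice.\<close>
  define G where "G x = F (LEAST n. x \<in> K n) x" for x
  have G: "G x = F n x" if "x \<in> K n" for x n
    unfolding G_def by (metis F_eq LeastI Least_le that)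
  have "continuous_map Y euclideanreal G"
    unfolding continuous_map_closedin
  proof (intro conjI allI impI)
    fix C :: "real set"
    assume C: "closedin euclidean C"
    show "closedin Y {x \<in> topspace Y. G x \<in> C}"
    \<comment> \<open>Coherence reduces continuity to the single pieces, and on \<open>J n\<close>
      the limit function \<open>G\<close> is \<open>F (Suc n)\<close>.\<close>
    proof (rule coherent)
      fix n
      have "J n \<subseteq> K (Suc n)"
        by (auto simp: K_def)
      then have "{x \<in> topspace Y. G x \<in> C} \<inter> J n = {x \<in> topspace Y \<inter> K (Suc n). F (Suc n) x \<in> C} \<inter> J n"
        using G by auto
      moreover have "closedin Y {x \<in> topspace Y \<inter> K (Suc n). F (Suc n) x \<in> C}"
        using F(1)[of "Suc n"] C K
        by (auto simp: P_def continuous_map_closedin closedin_closed_subtopology)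
      ultimately show "closedin Y ({x \<in> topspace Y. G x \<in> C} \<inter> J n)"
        using J by (simp add: closedin_Int)
    qed simp
  qed simp
  moreover have "A \<subseteq> K 0" "B \<subseteq> K 0"
    by (auto simp: K_def)
  then have "G ` A \<subseteq> {0}" "G ` B \<subseteq> {1}"
    using G[of _ 0] F(1)[of 0] by (auto simp: P_def subset_eq)
  ultimately show "\<exists>f. continuous_map Y euclideanreal f \<and> f ` A \<subseteq> {0} \<and> f ` B \<subseteq> {1}"
    by blast
qed

section \<open>Sequentiality, closed projections and the topological criterion\<close>

lemma metrizable_imp_sequential_space:
  assumes "metrizable_space X"
  shows "sequential_space X"
proof -
  obtain M d where "Metric_space M d" and X: "X = Metric_space.mtopology M d"
    using assms metrizable_space_def by metis
  then interpret Metric_space M d by simp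
  show ?thesis
    unfolding sequential_space_def sequentially_closed_in_def X metric_closedin_iff_sequentially_closed
    by (auto simp: image_subset_iff)
qed

text \<open>Continuous maps preserve convergence of sequences, so a sequentially closed set has
  sequentially closed preimages. These are closed in the sequential spaces \<open>X i\<close>, and
  coherence transfers this to \<open>Y\<close>.\<close>

lemma sequential_space_coherent_images:
  assumes seq: "\<And>i. i \<in> I \<Longrightarrow> sequential_space (X i)"
    and cont: "\<And>i. i \<in> I \<Longrightarrow> continuous_map (X i) Y (j i)"
    and coherent: "\<And>S. S \<subseteq> topspace Y \<Longrightarrow>
        (\<And>i. i \<in> I \<Longrightarrow> closedin (X i) {x \<in> topspace (X i). j i x \<in> S}) \<Longrightarrow> closedin Y S"
  shows "sequential_space Y"
  unfolding sequential_space_def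
proof (intro allI impI)
  fix S
  assume S: "sequentially_closed_in Y S"
  have S_closed: "l \<in> S" if "\<And>k. \<sigma> k \<in> S" "limitin Y \<sigma> l sequentially" for \<sigma> :: "nat \<Rightarrow> _" and l
    using S that by (auto simp: sequentially_closed_in_def)
  show "closedin Y S"
  proof (rule coherent)
    show "S \<subseteq> topspace Y"
      using S by (simp add: sequentially_closed_in_def)
    fix i assume i: "i \<in> I"
    have "j i l \<in> S"
      if "\<forall>k. j i (\<sigma> k) \<in> S" "limitin (X i) \<sigma> l sequentially" for \<sigma> :: "nat \<Rightarrow> _" and l
    proof -
      have "limitin Y (\<lambda>k. j i (\<sigma> k)) (j i l) sequentially"
        using continuous_map_limit[OF cont[OF i] that(2)] by (simp add: o_def)
      with that(1) show ?thesis
        using S_closed[of "\<lambda>k. j i (\<sigma> k)"] by simp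
    qed
    then have "sequentially_closed_in (X i) {x \<in> topspace (X i). j i x \<in> S}"
      unfolding sequentially_closed_in_def by (auto dest: limitin_topspace)
    then show "closedin (X i) {x \<in> topspace (X i). j i x \<in> S}"
      using seq[OF i] by (simp add: sequential_space_def)
  qed
qed

text \<open>Projection along a compact factor is a closed map. It serves twice: to eliminate the
  mixing weights, and to saturate a closed set of channels.\<close>

lemma closedin_relation_image:
  assumes R: "closedin (prod_topology X Z) R" and Z: "compact_space Z" and F: "closedin Z F"
  shows "closedin X {x \<in> topspace X. \<exists>y\<in>F. (x, y) \<in> R}"
proof -
  have "closedin X (fst ` (R \<inter> (topspace X \<times> F)))"
    using closed_map_fst[OF Z, of X] R F
    by (simp add: closed_map_def closedin_Int closedin_prod_Times_iff)
  moreover have "fst ` (R \<inter> (topspace X \<times> F)) = {x \<in> topspace X. \<exists>y\<in>F. (x, y) \<in> R}"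
    by force
  ultimately show ?thesis by simp
qed

text \<open>The purely topological half, meant for the channel spaces of fixed size as
  \<open>X i\<close> and the class maps as \<open>j i\<close>. The specific form of Shannon
  equivalence then enters only through closedness of the \<open>j i\<close>.\<close>

lemma countable_closed_images_imp_compactly_generated_sequential_T4:
  assumes I: "countable I" "I \<noteq> {}"
    and compact: "\<And>i. i \<in> I \<Longrightarrow> compact_space (X i)"
    and metrizable: "\<And>i. i \<in> I \<Longrightarrow> metrizable_space (X i)"
    and cont: "\<And>i. i \<in> I \<Longrightarrow> continuous_map (X i) Y (j i)"
    and closed: "\<And>i. i \<in> I \<Longrightarrow> closed_map (X i) Y (j i)"
    and cover: "topspace Y \<subseteq> (\<Union>i\<in>I. j i ` topspace (X i))"
    and coherent: "\<And>S. S \<subseteq> topspace Y \<Longrightarrow>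
        (\<And>i. i \<in> I \<Longrightarrow> closedin (X i) {x \<in> topspace (X i). j i x \<in> S}) \<Longrightarrow> closedin Y S"
  shows "compactly_generated_space Y \<and> sequential_space Y \<and> T4_space Y"
proof -
  define J where "J i = j i ` topspace (X i)" for i
  have J_closed: "closedin Y (J i)" if "i \<in> I" for i
    using closed[OF that] by (auto simp: closed_map_def J_def)
  have J_compact: "compactin Y (J i)" if "i \<in> I" for i
    unfolding J_def using compact[OF that] cont[OF that] image_compactin
    by (metis compact_space_def)
  \<comment> \<open>Coherence is restated for the images: closedness of
    \<open>S \<inter> J i\<close> pulls back along the continuous \<open>j i\<close>.\<close>
  have coherent_J: "closedin Y S"
    if S: "S \<subseteq> topspace Y" and SJ: "\<And>i. i \<in> I \<Longrightarrow> closedin Y (S \<inter> J i)" for S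
  proof (rule coherent[OF S])
    fix i assume i: "i \<in> I"
    have "{x \<in> topspace (X i). j i x \<in> S} = {x \<in> topspace (X i). j i x \<in> S \<inter> J i}"
      by (auto simp: J_def)
    then show "closedin (X i) {x \<in> topspace (X i). j i x \<in> S}"
      using closedin_continuous_map_preimage[OF cont[OF i] SJ[OF i]] by simp
  qed
  have "t1_space Y"
    unfolding t1_space_closedin_singleton
  proof
    fix y assume "y \<in> topspace Y"
    then obtain i x where i: "i \<in> I" and x: "x \<in> topspace (X i)" "y = j i x"
      using cover by blast
    have "closedin (X i) {x}"
      using metrizable_imp_t1_space[OF metrizable[OF i]] x(1) by (simp add: t1_space_closedin_singleton)
    then have "closedin Y (j i ` {x})"
      using closed[OF i] unfolding closed_map_def by blast
    then show "closedin Y {y}"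
      by (simp add: x)
  qed
  have J_normal: "normal_space (subtopology Y (J i))" if i: "i \<in> I" for i
  proof (rule normal_space_continuous_closed_map_image)
    show "normal_space (X i)"
      using metrizable[OF i] by (rule metrizable_imp_normal_space)
    show "continuous_map (X i) (subtopology Y (J i)) (j i)"
      using cont[OF i] by (auto simp: continuous_map_in_subtopology J_def)
    show "closed_map (X i) (subtopology Y (J i)) (j i)"
      using closed[OF i] by (auto simp: J_def intro: closed_map_into_subtopology)
    show "j i ` topspace (X i) = topspace (subtopology Y (J i))"
      using closedin_subset[OF J_closed[OF i]] by (auto simp: J_def)
  qed
  \<comment> \<open>\<open>from_nat_into\<close> enumerates the pieces, with harmless repetitions if
    \<open>I\<close> is finite.\<close>
  have "normal_space Y"
  proof (rule normal_space_coherent_countable_closed_cover[where J="\<lambda>n. J (from_nat_into I n)"])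
    show "closedin Y (J (from_nat_into I n))" "normal_space (subtopology Y (J (from_nat_into I n)))" for n
      using I(2) by (simp_all add: J_closed J_normal from_nat_into)
    have "(\<Union>n. J (from_nat_into I n)) = (\<Union>i\<in>I. J i)"
      using range_from_nat_into[OF I(2,1)] by (metis image_image)
    then show "topspace Y \<subseteq> (\<Union>n. J (from_nat_into I n))"
      using cover by (simp add: J_def)
    fix S assume "S \<subseteq> topspace Y" and S: "\<And>n. closedin Y (S \<inter> J (from_nat_into I n))"
    then show "closedin Y S"
      using from_nat_into_surj[OF I(1)] by (metis coherent_J)
  qed
  have "Hausdorff_space Y"
    using \<open>normal_space Y\<close> \<open>t1_space Y\<close> by (rule normal_t1_imp_Hausdorff_space)
  moreover have "sequential_space Y"
    by (rule sequential_space_coherent_images[where I=I and X=X and j=j])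
      (simp_all add: metrizable_imp_sequential_space metrizable cont coherent)
  \<comment> \<open>The images \<open>J i\<close> are themselves compact, so testing against compact
    sets includes testing against them.\<close>
  moreover have "closedin Y S"
    if "S \<subseteq> topspace Y" "\<And>K. compactin Y K \<Longrightarrow> closedin Y (S \<inter> K)" for S
    by (rule coherent_J[OF that(1) that(2)[OF J_compact]])
  ultimately show ?thesis
    using \<open>t1_space Y\<close> \<open>normal_space Y\<close>
    by (simp add: compactly_generated_space_def T4_space_def)
qed

lemma closedin_Collect_ball_eq:
  assumes "Hausdorff_space Y"
    and "\<And>i. i \<in> I \<Longrightarrow> continuous_map X Y (f i)" and "\<And>i. i \<in> I \<Longrightarrow> continuous_map X Y (g i)"
  shows "closedin X {x \<in> topspace X. \<forall>i\<in>I. f i x = g i x}"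
proof (cases "I = {}")
  case False
  then have "{x \<in> topspace X. \<forall>i\<in>I. f i x = g i x} = (\<Inter>i\<in>I. {x \<in> topspace X. f i x = g i x})"
    by auto
  then show ?thesis
    using False assms by (simp add: closedin_INT closedin_continuous_maps_eq)
qed simp

subsection \<open>Containment as a mixture of relabellings\<close>

declare One_nat_def [simp del]

text \<open>Inputs are mapped towards \<open>W'\<close> and outputs away from it, as for
  \<open>R\<close> and \<open>T\<close> in containment. Extensionality keeps the set finite.\<close>

definition letter_maps :: "nat \<Rightarrow> nat \<Rightarrow> nat \<Rightarrow> nat \<Rightarrow> ((nat \<Rightarrow> nat) \<times> (nat \<Rightarrow> nat)) set" where
  "letter_maps n' m' n m = ({1..n} \<rightarrow>\<^sub>E {1..n'}) \<times> ({1..m'} \<rightarrow>\<^sub>E {1..m})"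

text \<open>The entry at \<open>(x, y)\<close> of \<open>T \<circ> W' \<circ> R\<close> for the
  deterministic channels \<open>R\<close> and \<open>T\<close> given by \<open>f\<close> and
  \<open>g\<close>: the push-forward along \<open>g\<close> of row \<open>f x\<close> of
  \<open>W'\<close>.\<close>

definition relabel :: "nat \<Rightarrow> channel \<Rightarrow> (nat \<Rightarrow> nat) \<Rightarrow> (nat \<Rightarrow> nat) \<Rightarrow> nat \<Rightarrow> nat \<Rightarrow> real" where
  "relabel m' W' f g x y = (\<Sum>y'\<in>{1..m'}. of_bool (g y' = y) * W' (f x, y'))"

text \<open>Containment with a fixed finite index set in place of an arbitrary \<open>k\<close>, so
  that the weights live in one simplex depending only on the alphabet sizes.\<close>

definition relabelling_mixture ::
    "nat \<Rightarrow> nat \<Rightarrow> channel \<Rightarrow> nat \<Rightarrow> nat \<Rightarrow> channel \<Rightarrow> bool" where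
  "relabelling_mixture n' m' W' n m W \<longleftrightarrow>
     (\<exists>\<beta>. (\<forall>p\<in>letter_maps n' m' n m. 0 \<le> \<beta> p) \<and> sum \<beta> (letter_maps n' m' n m) = 1 \<and>
        (\<forall>x\<in>{1..n}. \<forall>y\<in>{1..m}.
           W (x, y) = (\<Sum>(f, g)\<in>letter_maps n' m' n m. \<beta> (f, g) * relabel m' W' f g x y)))"

lemma finite_letter_maps [simp]: "finite (letter_maps n' m' n m)"
  by (simp add: letter_maps_def finite_PiE)

lemma relabel_cong:
  assumes "f x = f' x" "\<And>y'. y' \<in> {1..m'} \<Longrightarrow> g y' = g' y'"
  shows "relabel m' W' f g x y = relabel m' W' f' g' x y"
  using assms by (simp add: relabel_def)

text \<open>Frees the index set and drops extensionality: indices whose maps restrict to the same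
  pair are merged and their weights added.\<close>

lemma relabelling_mixtureI:
  assumes I: "finite I" and \<alpha>: "\<And>i. i \<in> I \<Longrightarrow> 0 \<le> \<alpha> i" "sum \<alpha> I = 1"
    and f: "\<And>i. i \<in> I \<Longrightarrow> f i \<in> {1..n} \<rightarrow> {1..n'}" and g: "\<And>i. i \<in> I \<Longrightarrow> g i \<in> {1..m'} \<rightarrow> {1..m}"
    and W: "\<And>x y. x \<in> {1..n} \<Longrightarrow> y \<in> {1..m} \<Longrightarrow>
        W (x, y) = (\<Sum>i\<in>I. \<alpha> i * relabel m' W' (f i) (g i) x y)"
  shows "relabelling_mixture n' m' W' n m W"
proof -
  let ?D = "letter_maps n' m' n m"
  define h where "h i = (restrict (f i) {1..n}, restrict (g i) {1..m'})" for i
  define \<beta> where "\<beta> p = (\<Sum>i\<in>{i\<in>I. h i = p}. \<alpha> i)" for p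
  have h: "h ` I \<subseteq> ?D"
    using f g by (fastforce simp: h_def letter_maps_def Pi_iff)
  have "sum \<beta> ?D = 1"
    unfolding \<beta>_def using sum.group[OF I finite_letter_maps h, of \<alpha>] \<alpha>(2) by simp
  moreover have "0 \<le> \<beta> p" for p
    unfolding \<beta>_def using \<alpha>(1) by (auto intro: sum_nonneg)
  moreover have "W (x, y) = (\<Sum>(f, g)\<in>?D. \<beta> (f, g) * relabel m' W' f g x y)"
    if xy: "x \<in> {1..n}" "y \<in> {1..m}" for x y
  proof -
    let ?r = "\<lambda>p. relabel m' W' (fst p) (snd p) x y"
    have "W (x, y) = (\<Sum>i\<in>I. \<alpha> i * ?r (h i))"
      unfolding W[OF xy] h_def using xy by (intro sum.cong refl arg_cong2[of _ _ _ _ "(*)"] relabel_cong) auto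
    also have "\<dots> = (\<Sum>p\<in>?D. \<Sum>i\<in>{i\<in>I. h i = p}. \<alpha> i * ?r (h i))"
      using sum.group[OF I finite_letter_maps h, of "\<lambda>i. \<alpha> i * ?r (h i)"] by simp
    also have "\<dots> = (\<Sum>p\<in>?D. \<beta> p * ?r p)"
      by (simp add: \<beta>_def sum_distrib_right)
    finally show ?thesis
      by (simp add: case_prod_beta)
  qed
  ultimately show ?thesis
    unfolding relabelling_mixture_def by blast
qed

lemma relabel_id:
  assumes "y \<in> {1..m}"
  shows "relabel m W id id x y = W (x, y)"
  unfolding relabel_def using assms by (subst sum.remove[of _ y]) auto

lemma relabelling_mixture_refl: "relabelling_mixture n m W n m W"
  by (rule relabelling_mixtureI[where I="{()}" and \<alpha>="\<lambda>_. 1" and f="\<lambda>_. id" and g="\<lambda>_. id"])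
    (simp_all add: relabel_id)

text \<open>Relabelling twice is relabelling along composed maps, the input maps composing in the
  opposite order to the output maps; weights multiply.\<close>

lemma relabelling_mixture_trans:
  assumes "relabelling_mixture n1 m1 W1 n2 m2 W2" and "relabelling_mixture n2 m2 W2 n3 m3 W3"
  shows "relabelling_mixture n1 m1 W1 n3 m3 W3"
proof -
  let ?D = "letter_maps n1 m1 n2 m2" and ?E = "letter_maps n2 m2 n3 m3"
  obtain \<beta> where \<beta>: "\<And>p. p \<in> ?D \<Longrightarrow> 0 \<le> \<beta> p" "sum \<beta> ?D = 1"
    and W2: "\<And>x y. x \<in> {1..n2} \<Longrightarrow> y \<in> {1..m2} \<Longrightarrow>
        W2 (x, y) = (\<Sum>p\<in>?D. \<beta> p * relabel m1 W1 (fst p) (snd p) x y)"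
    using assms(1) unfolding relabelling_mixture_def case_prod_beta prod.collapse by blast
  obtain \<gamma> where \<gamma>: "\<And>q. q \<in> ?E \<Longrightarrow> 0 \<le> \<gamma> q" "sum \<gamma> ?E = 1"
    and W3: "\<And>x y. x \<in> {1..n3} \<Longrightarrow> y \<in> {1..m3} \<Longrightarrow>
        W3 (x, y) = (\<Sum>q\<in>?E. \<gamma> q * relabel m2 W2 (fst q) (snd q) x y)"
    using assms(2) unfolding relabelling_mixture_def case_prod_beta prod.collapse by blast
  show ?thesis
  proof (rule relabelling_mixtureI[where I="?E \<times> ?D" and \<alpha>="\<lambda>(q, p). \<gamma> q * \<beta> p"
        and f="\<lambda>(q, p). fst p \<circ> fst q" and g="\<lambda>(q, p). snd q \<circ> snd p"])
    show "(\<Sum>(q, p)\<in>?E \<times> ?D. \<gamma> q * \<beta> p) = 1"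
      using \<beta>(2) \<gamma>(2) by (simp flip: sum_product sum.cartesian_product)
    fix x z assume xz: "x \<in> {1..n3}" "z \<in> {1..m3}"
    have "relabel m2 W2 (fst q) (snd q) x z
        = (\<Sum>p\<in>?D. \<beta> p * relabel m1 W1 (fst p \<circ> fst q) (snd q \<circ> snd p) x z)" if q: "q \<in> ?E" for q
    proof -
      have fq: "fst q x \<in> {1..n2}"
        using q xz by (auto simp: letter_maps_def PiE_iff)
      have "relabel m2 W2 (fst q) (snd q) x z =
          (\<Sum>y\<in>{1..m2}. of_bool (snd q y = z) * (\<Sum>p\<in>?D. \<beta> p * relabel m1 W1 (fst p) (snd p) (fst q x) y))"
        unfolding relabel_def[of m2] using W2[OF fq] by (intro sum.cong) auto
      also have "\<dots> = (\<Sum>p\<in>?D. \<Sum>y\<in>{1..m2}. \<Sum>y'\<in>{1..m1}.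
          \<beta> p * of_bool (snd q y = z) * of_bool (snd p y' = y) * W1 (fst p (fst q x), y'))"
        unfolding relabel_def sum_distrib_left
        by (subst sum.swap) (simp add: mult_ac)
      \<comment> \<open>With the sum over \<open>y\<close> innermost,
        \<open>of_bool (snd p y' = y)\<close> leaves only the term at
        \<open>y = snd p y'\<close>.\<close>
      also have "\<dots> = (\<Sum>p\<in>?D. \<Sum>y'\<in>{1..m1}. \<Sum>y\<in>{1..m2}.
          \<beta> p * of_bool (snd q y = z) * of_bool (snd p y' = y) * W1 (fst p (fst q x), y'))"
        by (intro sum.cong refl sum.swap)
      also have "\<dots> = (\<Sum>p\<in>?D. \<Sum>y'\<in>{1..m1}. \<beta> p * (of_bool (snd q (snd p y') = z) * W1 (fst p (fst q x), y')))"
      proof (intro sum.cong refl)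
        fix p y' assume "p \<in> ?D" "y' \<in> {1..m1}"
        then have "snd p y' \<in> {1..m2}"
          by (auto simp: letter_maps_def PiE_iff)
        then show "(\<Sum>y\<in>{1..m2}. \<beta> p * of_bool (snd q y = z) * of_bool (snd p y' = y) * W1 (fst p (fst q x), y'))
            = \<beta> p * (of_bool (snd q (snd p y') = z) * W1 (fst p (fst q x), y'))"
          by (subst sum.remove[of _ "snd p y'"]) auto
      qed
      finally show ?thesis
        unfolding relabel_def sum_distrib_left comp_def .
    qed
    then have "W3 (x, z) = (\<Sum>q\<in>?E. \<Sum>p\<in>?D. \<gamma> q * \<beta> p *
        relabel m1 W1 (fst p \<circ> fst q) (snd q \<circ> snd p) x z)"
      unfolding W3[OF xz] by (simp add: sum_distrib_left mult.assoc)
    then show "W3 (x, z) = (\<Sum>i\<in>?E \<times> ?D. (case i of (q, p) \<Rightarrow> \<gamma> q * \<beta> p) *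
        relabel m1 W1 (case i of (q, p) \<Rightarrow> fst p \<circ> fst q) (case i of (q, p) \<Rightarrow> snd q \<circ> snd p) x z)"
      by (simp add: sum.cartesian_product case_prod_beta)
  qed (use \<beta>(1) \<gamma>(1) in \<open>auto simp: letter_maps_def PiE_iff Pi_iff finite_PiE\<close>)
qed

section \<open>Channels as averages of letter maps\<close>

text \<open>For a channel \<open>R\<close>, the probability of the letter map \<open>f\<close> when
  the image of each letter \<open>u\<close> is drawn independently from row \<open>u\<close> of
  \<open>R\<close>.\<close>

definition map_weight :: "nat \<Rightarrow> channel \<Rightarrow> (nat \<Rightarrow> nat) \<Rightarrow> real" where
  "map_weight n R f = (\<Prod>u\<in>{1..n}. R (u, f u))"

lemma map_weight_nonneg:
  assumes "R \<in> DMC n n'" "f \<in> {1..n} \<rightarrow>\<^sub>E {1..n'}"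
  shows "0 \<le> map_weight n R f"
  unfolding map_weight_def using assms by (intro prod_nonneg ballI) (auto simp: DMC_def PiE_iff)

lemma sum_map_weight:
  assumes "R \<in> DMC n n'"
  shows "sum (map_weight n R) ({1..n} \<rightarrow>\<^sub>E {1..n'}) = 1"
proof -
  have "sum (map_weight n R) ({1..n} \<rightarrow>\<^sub>E {1..n'}) = (\<Prod>u\<in>{1..n}. \<Sum>v\<in>{1..n'}. R (u, v))"
    unfolding map_weight_def by (rule prod_sum_PiE[symmetric]) auto
  also have "\<dots> = (\<Prod>u\<in>{1..n}. 1)"
    using assms by (intro prod.cong) (auto simp: DMC_def)
  finally show ?thesis by simp
qed

text \<open>
  Expand the product over all letters \<open>u\<close> of \<open>\<Sum>v. R (u, v) * F u v\<close>, where \<open>F\<close> is \<open>\<phi>\<close> at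
  \<open>u = x\<close> and \<open>1\<close> elsewhere: a channel is the average of the letter maps under the product weights.
\<close>

lemma channel_average:
  assumes R: "R \<in> DMC n n'" and x: "x \<in> {1..n}"
  shows "(\<Sum>v\<in>{1..n'}. R (x, v) * \<phi> v) = (\<Sum>f\<in>{1..n} \<rightarrow>\<^sub>E {1..n'}. map_weight n R f * \<phi> (f x))"
proof -
  let ?F = "\<lambda>u v. R (u, v) * (if u = x then \<phi> v else 1)"
  have "(\<Sum>v\<in>{1..n'}. R (x, v) * \<phi> v) = (\<Prod>u\<in>{1..n}. \<Sum>v\<in>{1..n'}. ?F u v)"
    using R x by (subst prod.remove[of _ x]) (auto simp: DMC_def)
  also have "\<dots> = (\<Sum>f\<in>{1..n} \<rightarrow>\<^sub>E {1..n'}. \<Prod>u\<in>{1..n}. ?F u (f u))"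
    by (rule prod_sum_PiE) auto
  also have "\<dots> = (\<Sum>f\<in>{1..n} \<rightarrow>\<^sub>E {1..n'}. map_weight n R f * \<phi> (f x))"
    using x by (simp add: prod.distrib map_weight_def)
  finally show ?thesis .
qed

text \<open>Averaging \<open>R\<close> over input maps and \<open>T\<close> over output maps
  independently turns the triple composition into a mixture with product weights.\<close>

lemma channel_comp_comp_eq_relabellings:
  assumes R: "R \<in> DMC n n'" and T: "T \<in> DMC m' m" and xz: "x \<in> {1..n}" "z \<in> {1..m}"
  shows "channel_comp n m' m T (channel_comp n n' m' W' R) (x, z)
    = (\<Sum>(f, g)\<in>letter_maps n' m' n m. map_weight n R f * map_weight m' T g * relabel m' W' f g x z)"
proof -
  let ?F = "{1..n} \<rightarrow>\<^sub>E {1..n'}" and ?G = "{1..m'} \<rightarrow>\<^sub>E {1..m}"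
  let ?t = "\<lambda>f g y'. map_weight n R f * map_weight m' T g * (of_bool (g y' = z) * W' (f x, y'))"
  have "channel_comp n m' m T (channel_comp n n' m' W' R) (x, z)
      = (\<Sum>y'\<in>{1..m'}. T (y', z) * (\<Sum>x'\<in>{1..n'}. R (x, x') * W' (x', y')))"
    using xz by (simp add: channel_comp_def mult.commute)
  \<comment> \<open>\<open>T (y', z)\<close> is written as the mean of the indicator of
    \<open>z\<close> under row \<open>y'\<close> of \<open>T\<close>, so that
    \<open>channel_average\<close> applies to \<open>T\<close> too.\<close>
  also have "\<dots> = (\<Sum>y'\<in>{1..m'}. (\<Sum>z'\<in>{1..m}. T (y', z') * of_bool (z' = z)) *
      (\<Sum>x'\<in>{1..n'}. R (x, x') * W' (x', y')))"
  proof -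
    have "(\<Sum>z'\<in>{1..m}. T (y', z') * of_bool (z' = z)) = T (y', z)" for y'
      using xz by (subst sum.remove[of _ z]) auto
    then show ?thesis by simp
  qed
  also have "\<dots> = (\<Sum>y'\<in>{1..m'}. (\<Sum>g\<in>?G. map_weight m' T g * of_bool (g y' = z)) *
      (\<Sum>f\<in>?F. map_weight n R f * W' (f x, y')))"
    by (intro sum.cong refl) (simp only: channel_average[OF R xz(1)] channel_average[OF T])
  also have "\<dots> = (\<Sum>y'\<in>{1..m'}. \<Sum>f\<in>?F. \<Sum>g\<in>?G. ?t f g y')"
    unfolding sum_product by (rule sum.cong[OF refl], subst sum.swap) (simp add: mult_ac)
  also have "\<dots> = (\<Sum>f\<in>?F. \<Sum>y'\<in>{1..m'}. \<Sum>g\<in>?G. ?t f g y')"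
    by (rule sum.swap)
  also have "\<dots> = (\<Sum>f\<in>?F. \<Sum>g\<in>?G. \<Sum>y'\<in>{1..m'}. ?t f g y')"
    by (intro sum.cong refl sum.swap)
  finally show ?thesis
    by (simp only: letter_maps_def relabel_def sum_distrib_left flip: sum.cartesian_product)
qed

text \<open>The index \<open>i\<close> and the letter maps merge into one index of weight
  \<open>\<alpha> i\<close> times both product weights; for fixed \<open>i\<close> the latter sum to
  1.\<close>

lemma channel_contains_imp_relabelling_mixture:
  assumes "channel_contains n' m' W' n m W"
  shows "relabelling_mixture n' m' W' n m W"
proof -
  obtain k :: nat and \<alpha> :: "nat \<Rightarrow> real" and R T :: "nat \<Rightarrow> channel"
    where \<alpha>: "\<forall>i\<in>{1..k}. 0 \<le> \<alpha> i" "sum \<alpha> {1..k} = 1"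
      and RT: "\<forall>i\<in>{1..k}. R i \<in> DMC n n' \<and> T i \<in> DMC m' m"
      and W: "\<forall>x\<in>{1..n}. \<forall>y\<in>{1..m}. W (x, y) = (\<Sum>i\<in>{1..k}. \<alpha> i *
              channel_comp n m' m (T i) (channel_comp n n' m' W' (R i)) (x, y))"
    using assms unfolding channel_contains_def by auto
  let ?D = "letter_maps n' m' n m"
  let ?w = "\<lambda>i p. map_weight n (R i) (fst p) * map_weight m' (T i) (snd p)"
  have w1: "sum (?w i) ?D = 1" if "i \<in> {1..k}" for i
  proof -
    have "sum (?w i) ?D = sum (map_weight n (R i)) ({1..n} \<rightarrow>\<^sub>E {1..n'}) *
        sum (map_weight m' (T i)) ({1..m'} \<rightarrow>\<^sub>E {1..m})"
      by (simp add: letter_maps_def sum_product sum.cartesian_product case_prod_beta)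
    then show ?thesis
      using RT that by (simp add: sum_map_weight)
  qed
  show ?thesis
  proof (rule relabelling_mixtureI[where I="{1..k} \<times> ?D" and \<alpha>="\<lambda>(i, p). \<alpha> i * ?w i p"
        and f="\<lambda>(i, p). fst p" and g="\<lambda>(i, p). snd p"])
    have "(\<Sum>(i, p)\<in>{1..k} \<times> ?D. \<alpha> i * ?w i p) = (\<Sum>i\<in>{1..k}. \<alpha> i * sum (?w i) ?D)"
      by (simp add: sum_distrib_left flip: sum.cartesian_product)
    then show "(\<Sum>(i, p)\<in>{1..k} \<times> ?D. \<alpha> i * ?w i p) = 1"
      using w1 \<alpha>(2) by simp
    fix x y assume xy: "x \<in> {1..n}" "y \<in> {1..m}"
    have "W (x, y) = (\<Sum>i\<in>{1..k}. \<Sum>p\<in>?D. \<alpha> i * ?w i p * relabel m' W' (fst p) (snd p) x y)"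
      using W xy RT
      by (simp add: channel_comp_comp_eq_relabellings case_prod_beta sum_distrib_left mult.assoc)
    then show "W (x, y) = (\<Sum>i\<in>{1..k} \<times> ?D. (case i of (i, p) \<Rightarrow> \<alpha> i * ?w i p) *
        relabel m' W' (case i of (i, p) \<Rightarrow> fst p) (case i of (i, p) \<Rightarrow> snd p) x y)"
      by (simp add: sum.cartesian_product case_prod_beta)
  qed (use \<alpha>(1) RT map_weight_nonneg in \<open>auto simp: letter_maps_def finite_PiE intro!: mult_nonneg_nonneg\<close>)
qed

definition letter_channel :: "nat \<Rightarrow> nat \<Rightarrow> (nat \<Rightarrow> nat) \<Rightarrow> channel" where
  "letter_channel n m f = (\<lambda>(x, y)\<in>{1..n} \<times> {1..m}. of_bool (f x = y))"

lemma letter_channel_in_DMC: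
  assumes "f \<in> {1..n} \<rightarrow> {1..m}"
  shows "letter_channel n m f \<in> DMC n m"
  using assms by (auto simp: letter_channel_def DMC_def Pi_iff of_bool_def sum.delta)

lemma channel_comp_letter_channels:
  assumes f: "f \<in> {1..n} \<rightarrow> {1..n'}" and g: "g \<in> {1..m'} \<rightarrow> {1..m}" and xz: "x \<in> {1..n}" "z \<in> {1..m}"
  shows "channel_comp n m' m (letter_channel m' m g) (channel_comp n n' m' W' (letter_channel n n' f)) (x, z)
    = relabel m' W' f g x z"
proof -
  have "f x \<in> {1..n'}"
    using f xz by auto
  then show ?thesis
    using xz
    by (simp add: channel_comp_def letter_channel_def relabel_def of_bool_def
        if_distrib[of "\<lambda>a. _ * a"] sum.delta cong: if_cong)
qed

text \<open>Each relabelling is a composition with two 0-1 channels; enumerating the pairs of letter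
  maps yields the \<open>k\<close> terms.\<close>

lemma relabelling_mixture_imp_channel_contains:
  assumes "relabelling_mixture n' m' W' n m W"
  shows "channel_contains n' m' W' n m W"
proof -
  let ?D = "letter_maps n' m' n m"
  obtain \<beta> where \<beta>: "\<And>p. p \<in> ?D \<Longrightarrow> 0 \<le> \<beta> p" "sum \<beta> ?D = 1"
    and W: "\<And>x y. x \<in> {1..n} \<Longrightarrow> y \<in> {1..m} \<Longrightarrow>
        W (x, y) = (\<Sum>p\<in>?D. \<beta> p * relabel m' W' (fst p) (snd p) x y)"
    using assms unfolding relabelling_mixture_def case_prod_beta prod.collapse by blast
  obtain e where e: "bij_betw e {1..card ?D} ?D"
    using ex_bij_betw_nat_finite_1[OF finite_letter_maps] by blast
  \<comment> \<open>Over an empty index set the weights would sum to 0; this supplies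
    \<open>k \<ge> 1\<close>.\<close>
  have "?D \<noteq> {}"
    using \<beta>(2) by auto
  then have "card ?D \<ge> 1"
    by (metis One_nat_def Suc_leI card_gt_0_iff finite_letter_maps)
  have eD: "e i \<in> ?D" if "i \<in> {1..card ?D}" for i
    using e that bij_betwE by blast
  have maps: "fst (e i) \<in> {1..n} \<rightarrow> {1..n'}" "snd (e i) \<in> {1..m'} \<rightarrow> {1..m}"
    if "i \<in> {1..card ?D}" for i
    using eD[OF that] by (auto simp: letter_maps_def)
  show ?thesis
    unfolding channel_contains_def
  proof (intro exI conjI ballI)
    show "card ?D \<ge> 1" by fact
    show "(\<Sum>i\<in>{1..card ?D}. \<beta> (e i)) = 1"
      using \<beta>(2) sum.reindex_bij_betw[OF e, of \<beta>] by simp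
    fix x y assume xy: "x \<in> {1..n}" "y \<in> {1..m}"
    have "W (x, y) = (\<Sum>i\<in>{1..card ?D}. \<beta> (e i) * relabel m' W' (fst (e i)) (snd (e i)) x y)"
      unfolding W[OF xy] by (rule sum.reindex_bij_betw[OF e, symmetric])
    also have "\<dots> = (\<Sum>i\<in>{1..card ?D}. \<beta> (e i) * channel_comp n m' m
        (letter_channel m' m (snd (e i))) (channel_comp n n' m' W' (letter_channel n n' (fst (e i)))) (x, y))"
      using maps xy by (intro sum.cong refl) (simp add: channel_comp_letter_channels)
    finally show "W (x, y) = (\<Sum>i\<in>{1..card ?D}. \<beta> (e i) * channel_comp n m' m
        (letter_channel m' m (snd (e i))) (channel_comp n n' m' W' (letter_channel n n' (fst (e i)))) (x, y))" .
  next
    fix i assume "i \<in> {1..card ?D}"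
    then show "0 \<le> \<beta> (e i)" "letter_channel n n' (fst (e i)) \<in> DMC n n'"
        "letter_channel m' m (snd (e i)) \<in> DMC m' m"
      by (simp_all add: \<beta>(1) eD maps letter_channel_in_DMC del: atLeastAtMost_iff)
  qed
qed

lemma channel_contains_iff_relabelling_mixture:
  "channel_contains n' m' W' n m W \<longleftrightarrow> relabelling_mixture n' m' W' n m W"
  using channel_contains_imp_relabelling_mixture relabelling_mixture_imp_channel_contains by blast

subsection \<open>Closedness of containment and the strong topology\<close>

lemma topspace_DMC_topology [simp]: "topspace (DMC_topology n m) = DMC n m"
  by (auto simp: DMC_topology_def DMC_def)

lemma metrizable_DMC_topology: "metrizable_space (DMC_topology n m)"
  unfolding DMC_topology_def
  by (intro metrizable_space_subtopology)
    (auto simp: metrizable_space_product_topology metrizable_space_euclidean countable_finite)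

lemma continuous_map_channel_entry [continuous_intros]:
  assumes "x \<in> {1..n}" "y \<in> {1..m}"
  shows "continuous_map (DMC_topology n m) euclideanreal (\<lambda>W. W (x, y))"
  unfolding DMC_topology_def using assms
  by (intro continuous_map_from_subtopology continuous_map_product_projection) auto

lemma channel_entry_le_1:
  assumes "W \<in> DMC n m" "x \<in> {1..n}" "y \<in> {1..m}"
  shows "W (x, y) \<le> 1"
proof -
  have "W (x, y) \<le> (\<Sum>y\<in>{1..m}. W (x, y))"
    using assms by (intro member_le_sum) (auto simp: DMC_def)
  then show ?thesis
    using assms by (simp add: DMC_def)
qed

text \<open>Row sums equal to 1 bound the nonnegative entries by 1, so \<open>DMC n m\<close> is cut
  out of a compact cube by closed equations.\<close>

lemma compact_DMC_topology: "compact_space (DMC_topology n m)"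
proof -
  let ?P = "product_topology (\<lambda>_. euclideanreal) ({1..n} \<times> {1..m})"
  let ?C = "{W \<in> topspace ?P. \<forall>x\<in>{1..n}. (\<Sum>y\<in>{1..m}. W (x, y)) = 1}"
  have "closedin ?P ?C"
    by (intro closedin_Collect_ball_eq[where Y=euclideanreal]) (auto intro!: continuous_map_sum continuous_map_product_projection)
  moreover have "compactin ?P ({1..n} \<times> {1..m} \<rightarrow>\<^sub>E {0..1})"
    by (simp add: compactin_PiE)
  ultimately have "compactin ?P (({1..n} \<times> {1..m} \<rightarrow>\<^sub>E {0..1}) \<inter> ?C)"
    by (intro compact_Int_closedin)
  moreover have "({1..n} \<times> {1..m} \<rightarrow>\<^sub>E {0..1}) \<inter> ?C = DMC n m"
  proof (intro subset_antisym subsetI)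
    fix W assume "W \<in> DMC n m"
    then show "W \<in> ({1..n} \<times> {1..m} \<rightarrow>\<^sub>E {0..1}) \<inter> ?C"
      using channel_entry_le_1[of W n m] by (auto simp: DMC_def PiE_iff)
  qed (auto simp: DMC_def PiE_iff)
  ultimately show ?thesis
    by (simp add: DMC_topology_def compact_space_subtopology)
qed

text \<open>
  The mixing weights are coded as a channel with a single input letter, so that they range over the
  compact space \<open>DMC_topology 1 N\<close>, and the relation is a projection along it.
\<close>

lemma closedin_channel_contains:
  "closedin (prod_topology (DMC_topology n m) (DMC_topology n' m'))
    {z \<in> DMC n m \<times> DMC n' m'. channel_contains n' m' (snd z) n m (fst z)}"
proof -
  let ?D = "letter_maps n' m' n m"
  let ?N = "card ?D"
  let ?X = "prod_topology (DMC_topology n m) (DMC_topology n' m')"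
  obtain e where e: "bij_betw e {1..?N} ?D"
    using ex_bij_betw_nat_finite_1[OF finite_letter_maps] by blast
  have eD: "e i \<in> ?D" if "i \<in> {1..?N}" for i
    using e that bij_betwE by blast
  let ?mix = "\<lambda>B W' x y. \<Sum>i\<in>{1..?N}. B (1, i) * relabel m' W' (fst (e i)) (snd (e i)) x y"
  let ?R = "{z \<in> topspace (prod_topology ?X (DMC_topology 1 ?N)). \<forall>(x, y)\<in>{1..n} \<times> {1..m}.
      fst (fst z) (x, y) = ?mix (snd z) (snd (fst z)) x y}"
  \<comment> \<open>\<open>B (1, i)\<close> is the weight of the pair \<open>e i\<close>. If there
    are no letter maps, \<open>DMC 1 0\<close> is empty too, since its row would sum to 0.\<close>
  have mix: "relabelling_mixture n' m' W' n m W \<longleftrightarrow>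
      (\<exists>B\<in>DMC 1 ?N. \<forall>x\<in>{1..n}. \<forall>y\<in>{1..m}. W (x, y) = ?mix B W' x y)" (is "?l \<longleftrightarrow> ?r") for W W'
  proof
    assume ?l
    then obtain \<beta> where \<beta>: "\<And>p. p \<in> ?D \<Longrightarrow> 0 \<le> \<beta> p" "sum \<beta> ?D = 1"
      and W: "\<And>x y. x \<in> {1..n} \<Longrightarrow> y \<in> {1..m} \<Longrightarrow>
          W (x, y) = (\<Sum>p\<in>?D. \<beta> p * relabel m' W' (fst p) (snd p) x y)"
      unfolding relabelling_mixture_def case_prod_beta prod.collapse by blast
    define B :: channel where "B = (\<lambda>(x, i)\<in>{1..1} \<times> {1..?N}. \<beta> (e i))"
    have "B \<in> DMC 1 ?N"
      using \<beta> sum.reindex_bij_betw[OF e, of \<beta>] eD by (auto simp: B_def DMC_def)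
    moreover have "W (x, y) = ?mix B W' x y" if "x \<in> {1..n}" "y \<in> {1..m}" for x y
      using W[OF that] sum.reindex_bij_betw[OF e, of "\<lambda>p. \<beta> p * relabel m' W' (fst p) (snd p) x y"]
      by (simp add: B_def)
    ultimately show ?r by blast
  next
    assume ?r
    then obtain B where B: "B \<in> DMC 1 ?N"
        and W: "\<And>x y. x \<in> {1..n} \<Longrightarrow> y \<in> {1..m} \<Longrightarrow> W (x, y) = ?mix B W' x y"
      by blast
    show ?l
      by (rule relabelling_mixtureI[OF _ _ _ _ _ W])
        (use B eD in \<open>auto simp: DMC_def letter_maps_def mem_Times_iff PiE_iff\<close>)
  qed
  \<comment> \<open>Letter maps send \<open>x\<close> to an actual input of \<open>W'\<close>, so
    each mixture entry is a polynomial in coordinates of \<open>B\<close> and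
    \<open>W'\<close>.\<close>
  have "continuous_map (prod_topology ?X (DMC_topology 1 ?N)) euclideanreal
      (\<lambda>z. ?mix (snd z) (snd (fst z)) x y)" if "x \<in> {1..n}" "y \<in> {1..m}" for x y
  proof -
    have "fst (e i) x \<in> {1..n'}" if "i \<in> {1..?N}" for i
      using eD[OF that] \<open>x \<in> {1..n}\<close> by (auto simp: letter_maps_def PiE_iff)
    then show ?thesis
      unfolding relabel_def
      by (intro continuous_map_sum continuous_map_real_mult continuous_map_real_mult_left
          continuous_map_compose[OF continuous_map_snd continuous_map_channel_entry, unfolded o_def]
          continuous_map_compose[OF continuous_map_compose[OF continuous_map_fst continuous_map_snd]
            continuous_map_channel_entry, unfolded o_def]) auto
  qed
  moreover have "continuous_map (prod_topology ?X (DMC_topology 1 ?N)) euclideanreal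
      (\<lambda>z. fst (fst z) (x, y))" if "x \<in> {1..n}" "y \<in> {1..m}" for x y
    using continuous_map_compose[OF continuous_map_compose[OF continuous_map_fst continuous_map_fst]
            continuous_map_channel_entry[OF that]] by (simp add: o_def)
  ultimately have "closedin (prod_topology ?X (DMC_topology 1 ?N)) ?R"
    unfolding case_prod_beta by (intro closedin_Collect_ball_eq[where Y=euclideanreal]) auto
  then have "closedin ?X {z \<in> topspace ?X. \<exists>B\<in>DMC 1 ?N. (z, B) \<in> ?R}"
    using closedin_topspace[of "DMC_topology 1 ?N"]
    by (intro closedin_relation_image[OF _ compact_DMC_topology]) auto
  moreover have "{z \<in> topspace ?X. \<exists>B\<in>DMC 1 ?N. (z, B) \<in> ?R} =
      {z \<in> DMC n m \<times> DMC n' m'. channel_contains n' m' (snd z) n m (fst z)}"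
    unfolding channel_contains_iff_relabelling_mixture mix by auto
  ultimately show ?thesis by simp
qed

section \<open>Shannon classes and the quotient map\<close>

lemma equiv_Shannon_equivalence: "equiv DMC_all Shannon_equivalence"
proof (rule equivI)
  show "Shannon_equivalence \<subseteq> DMC_all \<times> DMC_all"
    by (auto simp: Shannon_equivalence_def)
  show "refl_on DMC_all Shannon_equivalence"
    by (auto simp: refl_on_def Shannon_equivalence_def channel_contains_iff_relabelling_mixture
        relabelling_mixture_refl)
  show "sym Shannon_equivalence"
    by (auto simp: sym_def Shannon_equivalence_def)
  show "trans Shannon_equivalence"
    by (auto simp: trans_def Shannon_equivalence_def channel_contains_iff_relabelling_mixture
        intro: relabelling_mixture_trans)
qed

text \<open>The quotient map in curried form: fixing \<open>i\<close> restricts it to one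
  summand.\<close>

definition Shannon_class :: "nat \<times> nat \<Rightarrow> channel \<Rightarrow> ((nat \<times> nat) \<times> channel) set" where
  "Shannon_class i W = Shannon_equivalence `` {(i, W)}"

lemma quotient_map_Shannon_class:
  "quotient_map DMC_all_topology strong_topology (case_prod Shannon_class)"
  unfolding strong_topology_def Shannon_class_def
  using quotient_map_quotient_topology[of DMC_all_topology Shannon_equivalence]
  by (simp add: case_prod_beta')

lemma Shannon_class_eq_iff:
  assumes "n \<ge> 1" "m \<ge> 1" "W \<in> DMC n m" "n' \<ge> 1" "m' \<ge> 1" "W' \<in> DMC n' m'"
  shows "Shannon_class (n, m) W = Shannon_class (n', m') W' \<longleftrightarrow>
    channel_contains n m W n' m' W' \<and> channel_contains n' m' W' n m W"
  unfolding Shannon_class_def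
  using assms eq_equiv_class_iff[OF equiv_Shannon_equivalence, of "((n, m), W)" "((n', m'), W')"]
  by (auto simp: DMC_all_def Shannon_equivalence_def)

text \<open>Closedness in the quotient is closedness of the preimage, which the disjoint union tests
  summand by summand. This is the coherence hypothesis of the criterion.\<close>

lemma closedin_strong_topologyI:
  assumes S: "S \<subseteq> topspace strong_topology"
    and closed: "\<And>n m. n \<ge> 1 \<Longrightarrow> m \<ge> 1 \<Longrightarrow> closedin (DMC_topology n m) {W \<in> DMC n m. Shannon_class (n, m) W \<in> S}"
  shows "closedin strong_topology S"
proof -
  let ?U = "{p \<in> topspace DMC_all_topology. case_prod Shannon_class p \<in> S}"
  have "{W. ((n, m), W) \<in> ?U} = {W \<in> DMC n m. Shannon_class (n, m) W \<in> S}" if "n \<ge> 1" "m \<ge> 1" for n m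
    using that by (auto simp: topspace_DMC_all_topology DMC_all_def)
  then have "closedin DMC_all_topology ?U"
    unfolding DMC_all_topology_def closedin_sum_topology
    using closed by (auto simp: topspace_DMC_all_topology[unfolded DMC_all_topology_def] DMC_all_def)
  then show ?thesis
    using quotient_map_Shannon_class S by (simp add: quotient_map_closedin)
qed

lemma continuous_map_Shannon_class:
  assumes "n \<ge> 1" "m \<ge> 1"
  shows "continuous_map (DMC_topology n m) strong_topology (Shannon_class (n, m))"
proof -
  have "continuous_map (DMC_topology n m) DMC_all_topology (\<lambda>W. ((n, m), W))"
    unfolding DMC_all_topology_def
    using continuous_map_component_injection[of "(n, m)" "{1..} \<times> {1..}" "\<lambda>(n, m). DMC_topology n m"] assms
    by simp
  from continuous_map_compose[OF this quotient_imp_continuous_map[OF quotient_map_Shannon_class]]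
  show ?thesis by (simp add: o_def)
qed

text \<open>The trace on \<open>DMC n' m'\<close> of the saturation of \<open>F\<close> is the image
  of \<open>F\<close> under containment in both directions. This relation is closed and
  \<open>DMC n m\<close> is compact, so the trace is closed.\<close>

lemma closed_map_Shannon_class:
  assumes nm: "n \<ge> 1" "m \<ge> 1"
  shows "closed_map (DMC_topology n m) strong_topology (Shannon_class (n, m))"
  unfolding closed_map_def
proof (intro allI impI)
  fix F assume F: "closedin (DMC_topology n m) F"
  then have FD: "F \<subseteq> DMC n m"
    using closedin_subset by force
  show "closedin strong_topology (Shannon_class (n, m) ` F)"
  proof (rule closedin_strong_topologyI)
    show "Shannon_class (n, m) ` F \<subseteq> topspace strong_topology"
      using continuous_map_image_subset_topspace[OF continuous_map_Shannon_class[OF nm]] FD by auto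
    fix n' m' :: nat assume nm': "n' \<ge> 1" "m' \<ge> 1"
    let ?X = "prod_topology (DMC_topology n' m') (DMC_topology n m)"
    let ?A = "{z \<in> DMC n' m' \<times> DMC n m. channel_contains n m (snd z) n' m' (fst z)}"
    let ?B = "{z \<in> DMC n m \<times> DMC n' m'. channel_contains n' m' (snd z) n m (fst z)}"
    \<comment> \<open>The reverse containment, moved to the product \<open>?X\<close> by swapping
      coordinates.\<close>
    let ?B' = "{z \<in> topspace ?X. (snd z, fst z) \<in> ?B}"
    have "closedin ?X ?B'"
      by (rule closedin_continuous_map_preimage[OF _ closedin_channel_contains])
        (simp add: continuous_map_pairedI continuous_map_fst continuous_map_snd)
    then have "closedin (DMC_topology n' m') {W \<in> topspace (DMC_topology n' m'). \<exists>W'\<in>F. (W, W') \<in> ?A \<inter> ?B'}"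
      by (intro closedin_relation_image[OF _ compact_DMC_topology F] closedin_Int closedin_channel_contains)
    moreover have "{W \<in> topspace (DMC_topology n' m'). \<exists>W'\<in>F. (W, W') \<in> ?A \<inter> ?B'} =
        {W \<in> DMC n' m'. Shannon_class (n', m') W \<in> Shannon_class (n, m) ` F}"
    proof -
      have "(W, W') \<in> ?A \<inter> ?B' \<longleftrightarrow> Shannon_class (n', m') W = Shannon_class (n, m) W'"
        if "W \<in> DMC n' m'" "W' \<in> F" for W W'
        using Shannon_class_eq_iff[OF nm' that(1) nm subsetD[OF FD that(2)]] that(1) subsetD[OF FD that(2)]
        by simp blast
      then show ?thesis
        by (simp add: image_iff cong: conj_cong)
    qed
    ultimately show "closedin (DMC_topology n' m')
        {W \<in> DMC n' m'. Shannon_class (n', m') W \<in> Shannon_class (n, m) ` F}"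
      by simp
  qed
qed

theorem theorem4:
  shows "compactly_generated_space strong_topology
       \<and> sequential_space strong_topology
       \<and> T4_space strong_topology"
proof (rule countable_closed_images_imp_compactly_generated_sequential_T4
    [where I="{1..} \<times> {1..}" and X="\<lambda>(n, m). DMC_topology n m" and j=Shannon_class])
  have "topspace strong_topology = case_prod Shannon_class ` DMC_all"
    using quotient_imp_surjective_map[OF quotient_map_Shannon_class]
    by (simp add: topspace_DMC_all_topology)
  then show "topspace strong_topology \<subseteq>
      (\<Union>i\<in>{1..} \<times> {1..}. Shannon_class i ` topspace (case i of (n, m) \<Rightarrow> DMC_topology n m))"
    by (auto simp: DMC_all_def)
  fix S
  assume "S \<subseteq> topspace strong_topology"
    and closed: "\<And>i. i \<in> {1..} \<times> {1..} \<Longrightarrow> closedin (case i of (n, m) \<Rightarrow> DMC_topology n m)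
          {W \<in> topspace (case i of (n, m) \<Rightarrow> DMC_topology n m). Shannon_class i W \<in> S}"
  then show "closedin strong_topology S"
    using closed[of "(_, _)"] by (intro closedin_strong_topologyI) auto
qed (auto simp: compact_DMC_topology metrizable_DMC_topology continuous_map_Shannon_class
    closed_map_Shannon_class)

end
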